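(* Let $s$ be a $q$-function on an open interval $\mathcal{X}\subseteq\mathbb{R}$. The following conditions are equivalent (so $s$ is a key local score function if and only if any one, and then all, of them holds): (i) $s$ satisfies the key equation $Ls=0$; (ii) $s=(I-L)g$ for some $0$-homogeneous $q$-function $g$; (iii) $s=\Lambda\phi$ for some $1$-homogeneous $q$-function $\phi$. Moreover, when these conditions hold, $s$ is $0$-homogeneous.
   Context: Let $\mathcal{X}\subseteq\mathbb{R}$ be an open interval (possibly unbounded). A $q$-function of order $m$ ($m\ge 0$ an integer) is an infinitely differentiable real-valued function $f(x,q_0,q_1,\ldots,q_m)$ on $\mathcal{X}\times\mathbb{R}^+\times\mathbb{R}^m$, where $x\in\mathcal{X}$, $q_0\in\mathbb{R}^+=(0,\infty)$ and $q_1,\ldots,q_m\in\mathbb{R}$. A $q$-function is a $q$-function of some finite order; a $q$-function of order $m$ is also regarded as one of any order $m'\ge m$ that does not depend on $q_{m+1},\ldots,q_{m'}$. Write $\mathbf{q}=(q_0,q_1,\ldots)$. Operators on $q$-functions (all sums are finite on any given $q$-function; $I$ is the identity): $$D=\frac{\partial}{\partial x}+\sum_{j\ge0}q_{j+1}\frac{\partial}{\partial q_j},\qquad Lf=\sum_{k\ge0}(-1)^{k+1}D^k\Bigl(q_0\frac{\partial f}{\partial q_k}\Bigr),\qquad \Lambda f=\sum_{k\ge0}(-1)^kD^k\Bigl(\frac{\partial f}{\partial q_k}\Bigr).$$ A $q$-function $f$ is $h$-homogeneous if $f(x,\lambda\mathbf{q})=\lambda^hf(x,\mathbf{q})$ for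 all $\lambda>0$ and all $x,\mathbf{q}$. A key local score function is a $q$-function $s$ with $Ls=0$. *)

theory Defs
  imports "HOL-Analysis.Analysis"
begin

text \<open>
  A function of \<open>(x, q\<^sub>0, q\<^sub>1, \<dots>)\<close> takes a real argument and a sequence \<open>q\<close>. Only
  its values on the domain (\<open>x \<in> X\<close> and \<open>q 0 > 0\<close>) are relevant: two q-functions
  are identified when they agree there, and values elsewhere are arbitrary.
\<close>

type_synonym qfun = "real \<Rightarrow> (nat \<Rightarrow> real) \<Rightarrow> real"

definition qdom :: "real set \<Rightarrow> (real \<times> (nat \<Rightarrow> real)) set" where
  "qdom X = {(x, q). x \<in> X \<and> q 0 > 0}"

definition qeq :: "real set \<Rightarrow> qfun \<Rightarrow> qfun \<Rightarrow> bool" where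
  "qeq X f g \<longleftrightarrow> (\<forall>(x, q) \<in> qdom X. f x q = g x q)"

definition dx :: "qfun \<Rightarrow> qfun" where
  "dx f = (\<lambda>x q. deriv (\<lambda>t. f t q) x)"

definition dq :: "nat \<Rightarrow> qfun \<Rightarrow> qfun" where
  "dq j f = (\<lambda>x q. deriv (\<lambda>t. f x (q(j := t))) (q j))"

text \<open>
  \<open>Ck_on X k f\<close>: all iterated partial derivatives of \<open>f\<close> of order at most \<open>k\<close>, taken
  in any sequence of variables, exist and are continuous on the domain. Continuity
  is with respect to the product topology on sequences; for a function of only
  \<open>q\<^sub>0, \<dots>, q\<^sub>m\<close> this is ordinary continuity in finitely many real variables.
\<close>

primrec Ck_on :: "real set \<Rightarrow> nat \<Rightarrow> qfun \<Rightarrow> bool" where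
  "Ck_on X 0 f \<longleftrightarrow> continuous_on (qdom X) (\<lambda>(x, q). f x q)"
| "Ck_on X (Suc k) f \<longleftrightarrow>
     continuous_on (qdom X) (\<lambda>(x, q). f x q) \<and>
     (\<forall>(x, q) \<in> qdom X. (\<lambda>t. f t q) differentiable (at x)) \<and>
     (\<forall>j. \<forall>(x, q) \<in> qdom X. (\<lambda>t. f x (q(j := t))) differentiable (at (q j))) \<and>
     Ck_on X k (dx f) \<and> (\<forall>j. Ck_on X k (dq j f))"

definition q_function_of_order :: "real set \<Rightarrow> nat \<Rightarrow> qfun \<Rightarrow> bool" where
  "q_function_of_order X m f \<longleftrightarrow>
     (\<forall>x q q'. (x, q) \<in> qdom X \<longrightarrow> (\<forall>j\<le>m. q' j = q j) \<longrightarrow> f x q' = f x q) \<and>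
     (\<forall>k. Ck_on X k f)"

definition q_function :: "real set \<Rightarrow> qfun \<Rightarrow> bool" where
  "q_function X f \<longleftrightarrow> (\<exists>m. q_function_of_order X m f)"

text \<open>
  The series below are finite sums for q-functions: if \<open>f\<close> has order \<open>m\<close>, then
  \<open>dq j f\<close> vanishes on the domain for every \<open>j > m\<close>.
\<close>

definition total_D :: "qfun \<Rightarrow> qfun" where
  "total_D f = (\<lambda>x q. dx f x q + (\<Sum>j. q (Suc j) * dq j f x q))"

definition L_op :: "qfun \<Rightarrow> qfun" where
  "L_op f = (\<lambda>x q. \<Sum>k. (-1) ^ (k + 1) * (total_D ^^ k) (\<lambda>x q. q 0 * dq k f x q) x q)"

definition Lambda_op :: "qfun \<Rightarrow> qfun" where
  "Lambda_op f = (\<lambda>x q. \<Sum>k. (-1) ^ k * (total_D ^^ k) (dq k f) x q)"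

definition q_homogeneous :: "real set \<Rightarrow> real \<Rightarrow> qfun \<Rightarrow> bool" where
  "q_homogeneous X h f \<longleftrightarrow>
     (\<forall>c>0. \<forall>(x, q) \<in> qdom X. f x (\<lambda>j. c * q j) = c powr h * f x q)"

definition key_equation :: "real set \<Rightarrow> qfun \<Rightarrow> bool" where
  "key_equation X s \<longleftrightarrow> qeq X (L_op s) (\<lambda>x q. 0)"

definition key_local_score :: "real set \<Rightarrow> qfun \<Rightarrow> bool" where
  "key_local_score X s \<longleftrightarrow> q_function X s \<and> key_equation X s"

end

theory Submission
  imports Defs
begin

text \<open>
  The proof rests on the algebra of the Euler operator \<open>E = \<Sum>\<^sub>j q\<^sub>j \<partial>/\<partial>q\<^sub>j\<close>, the total
  derivative \<open>D\<close> and the Euler-Lagrange operator \<open>\<Lambda>\<close>, through four identities: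

  \<^item> \<open>\<Lambda> (q\<^sub>0 f) = (I - L) f\<close> (\<open>Lambda_q0_mult\<close>);
  \<^item> \<open>\<Lambda> D = 0\<close> (\<open>Lambda_total_D\<close>);
  \<^item> \<open>\<Lambda> E = E \<Lambda> + \<Lambda>\<close> (\<open>Lambda_euler\<close>);
  \<^item> \<open>q\<^sub>0 \<Lambda> f = E f + D \<psi>\<close> for some q-function \<open>\<psi>\<close> (\<open>q0_Lambda\<close>).

  By the first identity, conditions (ii) and (iii) correspond to each other under
  \<open>\<phi> = q\<^sub>0 g\<close>. If \<open>\<phi>\<close> is 1-homogeneous, then \<open>E \<phi> = \<phi>\<close>, so \<open>q\<^sub>0 \<Lambda> \<phi> = \<phi> + D \<psi>\<close>, and applying
  \<open>\<Lambda>\<close> gives \<open>(I - L) \<Lambda> \<phi> = \<Lambda> \<phi>\<close>; hence (iii) implies (i).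

  Conversely, let \<open>L s = 0\<close>. Then \<open>s = (I - L) s\<close>, so \<open>g = s\<close> witnesses (ii) as soon as
  \<open>s\<close> is known to be 0-homogeneous. To see this put \<open>\<phi> = q\<^sub>0 s\<close>. Then \<open>\<Lambda> \<phi> = s\<close>, so
  \<open>\<phi> = q\<^sub>0 \<Lambda> \<phi> = E \<phi> + D \<psi>\<close>, and applying \<open>\<Lambda>\<close> yields \<open>s = \<Lambda> (E \<phi>) = E s + s\<close>. Thus
  \<open>E s = 0\<close>, and \<open>s\<close> is constant along the rays \<open>\<lambda> \<mapsto> (x, \<lambda> q)\<close>.

  The identities follow from the commutation rule
  \<open>\<partial>/\<partial>q\<^sub>k D = D \<partial>/\<partial>q\<^sub>k + \<partial>/\<partial>q\<^bsub>k-1\<^esub>\<close> (\<open>dq_total_D\<close>), hence from the symmetry of mixed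
  partial derivatives, and from the product rule for \<open>D\<close>. The link between \<open>E\<close> and
  homogeneity is the chain rule along rays (\<open>deriv_scale\<close>).
\<close>

section \<open>Symmetry of mixed partial derivatives\<close>

text \<open>Both mixed partials are limits of the same symmetric second difference: the mean
  value theorem, applied once in each variable and in either order, writes the
  difference over a small square as the side squared times a value of either mixed
  partial inside the square.\<close>

lemma mixed_partials_commute:
  fixes F Fs Ft Fst Fts :: "real \<Rightarrow> real \<Rightarrow> real"
  assumes "open U" "(a, b) \<in> U"
    and Fs: "\<And>s t. (s, t) \<in> U \<Longrightarrow> ((\<lambda>s. F s t) has_real_derivative Fs s t) (at s)"
    and Ft: "\<And>s t. (s, t) \<in> U \<Longrightarrow> ((\<lambda>t. F s t) has_real_derivative Ft s t) (at t)"
    and Fst: "\<And>s t. (s, t) \<in> U \<Longrightarrow> ((\<lambda>t. Fs s t) has_real_derivative Fst s t) (at t)"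
    and Fts: "\<And>s t. (s, t) \<in> U \<Longrightarrow> ((\<lambda>s. Ft s t) has_real_derivative Fts s t) (at s)"
    and cont: "continuous_on U (\<lambda>(s, t). Fst s t)" "continuous_on U (\<lambda>(s, t). Fts s t)"
  shows "Fst a b = Fts a b"
proof (rule ccontr)
  assume ne: "Fst a b \<noteq> Fts a b"
  define e where "e = \<bar>Fst a b - Fts a b\<bar> / 2"
  have e: "e > 0" using ne by (simp add: e_def)
  have "isCont (\<lambda>(s, t). Fst s t) (a, b)" "isCont (\<lambda>(s, t). Fts s t) (a, b)"
    using cont assms(1,2) by (simp_all add: continuous_on_eq_continuous_at)
  then obtain d1 d2 where d1: "d1 > 0" "\<And>p. dist p (a, b) < d1 \<Longrightarrow> dist (case_prod Fst p) (Fst a b) < e"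
    and d2: "d2 > 0" "\<And>p. dist p (a, b) < d2 \<Longrightarrow> dist (case_prod Fts p) (Fts a b) < e"
    using e unfolding continuous_at_eps_delta by (metis (no_types, lifting) case_prod_conv)
  obtain d3 where d3: "d3 > 0" "ball (a, b) d3 \<subseteq> U"
    using assms(1,2) open_contains_ball by blast
  \<comment> \<open>A third rather than a half keeps the far corner of the square strictly inside the ball.\<close>
  define h where "h = min d1 (min d2 d3) / 3"
  have h: "h > 0" using d1 d2 d3 by (simp add: h_def)
  have near: "dist (s, t) (a, b) < min d1 (min d2 d3)" if "a \<le> s" "s \<le> a + h" "b \<le> t" "t \<le> b + h" for s t
  proof -
    have "dist (s, t) (a, b) \<le> dist s a + dist t b"
      by (simp add: dist_prod_def sqrt_sum_squares_le_sum)
    also have "\<dots> \<le> 2 * h" using that by (auto simp: dist_real_def)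
    also have "\<dots> < 3 * h" using h by simp
    also have "3 * h = min d1 (min d2 d3)" by (simp add: h_def)
    finally show ?thesis .
  qed
  have U: "(s, t) \<in> U" if "a \<le> s" "s \<le> a + h" "b \<le> t" "t \<le> b + h" for s t
    using near[OF that] d3 by (auto simp: dist_commute)
  define \<Delta> where "\<Delta> = F (a + h) (b + h) - F (a + h) b - F a (b + h) + F a b"
  have "\<exists>s>a. s < a + h \<and> (F (a + h) (b + h) - F (a + h) b) - (F a (b + h) - F a b)
      = ((a + h) - a) * (Fs s (b + h) - Fs s b)"
    using h by (intro MVT2[where f = "\<lambda>s. F s (b + h) - F s b"]) (auto intro!: DERIV_diff Fs U)
  then obtain s where s: "a < s" "s < a + h" "\<Delta> = h * (Fs s (b + h) - Fs s b)"
    by (auto simp: \<Delta>_def)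
  have "\<exists>t>b. t < b + h \<and> Fs s (b + h) - Fs s b = ((b + h) - b) * Fst s t"
    using h s by (intro MVT2) (auto intro!: Fst U)
  then obtain t where t: "b < t" "t < b + h" "\<Delta> = h * (h * Fst s t)"
    using s by auto
  have "\<exists>t'>b. t' < b + h \<and> (F (a + h) (b + h) - F a (b + h)) - (F (a + h) b - F a b)
      = ((b + h) - b) * (Ft (a + h) t' - Ft a t')"
    using h by (intro MVT2[where f = "\<lambda>t. F (a + h) t - F a t"]) (auto intro!: DERIV_diff Ft U)
  then obtain t' where t': "b < t'" "t' < b + h" "\<Delta> = h * (Ft (a + h) t' - Ft a t')"
    by (auto simp: \<Delta>_def)
  have "\<exists>s'>a. s' < a + h \<and> Ft (a + h) t' - Ft a t' = ((a + h) - a) * Fts s' t'"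
    using h t' by (intro MVT2) (auto intro!: Fts U)
  then obtain s' where s': "a < s'" "s' < a + h" "\<Delta> = h * (h * Fts s' t')"
    using t' by auto
  have "Fst s t = Fts s' t'" using t(3) s'(3) h by simp
  moreover have "dist (Fst s t) (Fst a b) < e" "dist (Fts s' t') (Fts a b) < e"
    using d1(2)[of "(s, t)"] d2(2)[of "(s', t')"] near[of s t] near[of s' t'] s t s' t' by auto
  ultimately have "dist (Fst a b) (Fts a b) < \<bar>Fst a b - Fts a b\<bar>"
    unfolding e_def by (metis dist_triangle_half_r)
  then show False by (simp add: dist_real_def)
qed

section \<open>Partial derivatives on the domain\<close>

text \<open>The index \<open>None\<close> stands for the variable \<open>x\<close> and \<open>Some j\<close> for \<open>q\<^sub>j\<close>. With a
  single family of partial derivatives, each rule of calculus is proved once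
  instead of once for \<open>dx\<close> and once for \<open>dq\<close>.\<close>

definition coord :: "nat option \<Rightarrow> real \<times> (nat \<Rightarrow> real) \<Rightarrow> real" where
  "coord v p = (case v of None \<Rightarrow> fst p | Some j \<Rightarrow> snd p j)"

definition upd :: "nat option \<Rightarrow> real \<Rightarrow> real \<times> (nat \<Rightarrow> real) \<Rightarrow> real \<times> (nat \<Rightarrow> real)" where
  "upd v t p = (case v of None \<Rightarrow> (t, snd p) | Some j \<Rightarrow> (fst p, (snd p)(j := t)))"

definition pd :: "nat option \<Rightarrow> qfun \<Rightarrow> qfun" where
  "pd v f = (case v of None \<Rightarrow> dx f | Some j \<Rightarrow> dq j f)"

text \<open>Since \<open>deriv\<close> has a value even where no derivative exists, the product and sum
  rules are stated for this relation, and transferred to \<open>pd\<close> by \<open>has_pd_unique\<close>.\<close>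

definition has_pd :: "real set \<Rightarrow> nat option \<Rightarrow> qfun \<Rightarrow> qfun \<Rightarrow> bool" where
  "has_pd X v f f' \<longleftrightarrow> (\<forall>p \<in> qdom X.
     ((\<lambda>t. case_prod f (upd v t p)) has_real_derivative case_prod f' p) (at (coord v p)))"

lemma pd_None [simp]: "pd None f = dx f" and pd_Some [simp]: "pd (Some j) f = dq j f"
  by (simp_all add: pd_def)

lemma pd_eq_deriv: "pd v f x q = deriv (\<lambda>t. case_prod f (upd v t (x, q))) (coord v (x, q))"
  by (cases v) (simp_all add: pd_def dx_def dq_def upd_def coord_def)

lemma coord_upd [simp]: "coord v (upd v t p) = t" "v \<noteq> w \<Longrightarrow> coord v (upd w t p) = coord v p"
  by (auto simp: coord_def upd_def split: option.splits)

lemma upd_upd [simp]: "upd v t (upd v u p) = upd v t p"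
  and upd_coord [simp]: "upd v (coord v p) p = p"
  by (auto simp: coord_def upd_def split: option.splits)

lemma upd_commute: "v \<noteq> w \<Longrightarrow> upd v t (upd w u p) = upd w u (upd v t p)"
  by (auto simp: upd_def fun_eq_iff split: option.splits)

lemma coord_None [simp]: "coord None (x, q) = x" and coord_Some [simp]: "coord (Some j) (x, q) = q j"
  and upd_None [simp]: "upd None t (x, q) = (t, q)" and upd_Some [simp]: "upd (Some j) t (x, q) = (x, q(j := t))"
  by (simp_all add: coord_def upd_def)

lemma continuous_on_snd_coord [continuous_intros]:
  fixes p :: "'a::topological_space \<Rightarrow> 'b::topological_space \<times> (nat \<Rightarrow> real)"
  shows "continuous_on S p \<Longrightarrow> continuous_on S (\<lambda>z. snd (p z) j)"
  by (rule continuous_on_product_then_coordinatewise[OF continuous_on_snd])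

lemma continuous_on_upd [continuous_intros]:
  fixes p :: "'a::topological_space \<Rightarrow> real \<times> (nat \<Rightarrow> real)"
  assumes "continuous_on S p" "continuous_on S r"
  shows "continuous_on S (\<lambda>z. upd v (r z) (p z))"
proof (cases v)
  case (Some j)
  have "continuous_on S (\<lambda>z. ((snd (p z))(j := r z)) i)" for i
    using assms by (cases "i = j") (simp_all add: continuous_on_snd_coord)
  then have "continuous_on S (\<lambda>z. (snd (p z))(j := r z))"
    by (rule continuous_on_coordinatewise_then_product)
  then show ?thesis
    using assms(1) Some by (simp add: upd_def continuous_on_Pair continuous_on_fst)
qed (simp add: upd_def assms continuous_on_Pair continuous_on_snd)

text \<open>The recursion equations for \<open>Ck_on\<close> with the variables treated uniformly replace
  the defining ones as the working interface.\<close>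

lemma Ck_on_0: "Ck_on X 0 f \<longleftrightarrow> continuous_on (qdom X) (case_prod f)"
  by simp

lemma Ck_on_Suc: "Ck_on X (Suc k) f \<longleftrightarrow> continuous_on (qdom X) (case_prod f) \<and>
    (\<forall>v. has_pd X v f (pd v f) \<and> Ck_on X k (pd v f))"
proof -
  have "has_pd X v f (pd v f) \<longleftrightarrow>
      (\<forall>p \<in> qdom X. (\<lambda>t. case_prod f (upd v t p)) differentiable (at (coord v p)))" for v
    unfolding has_pd_def by (auto simp: pd_eq_deriv DERIV_deriv_iff_real_differentiable)
  moreover have "(\<forall>v. Q v) \<longleftrightarrow> Q None \<and> (\<forall>j. Q (Some j))" for Q :: "nat option \<Rightarrow> bool"
    by (simp add: split_option_all)
  ultimately show ?thesis
    by (simp add: split_paired_all Ball_def) blast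
qed
declare Ck_on.simps [simp del]

lemma qeq_iff: "qeq X f g \<longleftrightarrow> (\<forall>p\<in>qdom X. case_prod f p = case_prod g p)"
  by (auto simp: qeq_def)

lemma qeqI: "(\<And>x q. (x, q) \<in> qdom X \<Longrightarrow> f x q = g x q) \<Longrightarrow> qeq X f g"
  and qeqD: "qeq X f g \<Longrightarrow> (x, q) \<in> qdom X \<Longrightarrow> f x q = g x q"
  by (auto simp: qeq_def)

lemma qeq_refl [simp]: "qeq X f f"
  and qeq_sym: "qeq X f g \<Longrightarrow> qeq X g f"
  and qeq_trans [trans]: "qeq X f g \<Longrightarrow> qeq X g h \<Longrightarrow> qeq X f h"
  by (fastforce simp: qeq_def)+

locale open_domain =
  fixes X :: "real set"
  assumes open_X: "open X"
begin

lemma open_qdom: "open (qdom X)"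
proof -
  have "qdom X = (X \<times> UNIV) \<inter> {p. 0 < snd p 0}" by (auto simp: qdom_def)
  moreover have "open {p :: real \<times> (nat \<Rightarrow> real). 0 < snd p 0}"
    by (intro open_Collect_less continuous_intros)
  ultimately show ?thesis using open_X by (auto intro!: open_Int open_Times)
qed

lemma open_upd: "open {t. upd v t p \<in> qdom X}"
proof -
  have "continuous_on UNIV (\<lambda>t. upd v t p)"
    by (intro continuous_intros)
  from open_vimage[OF open_qdom this] show ?thesis
    by (simp add: vimage_def)
qed

text \<open>The domain is open in each variable separately, so partial derivatives at its
  points depend only on values taken inside it. This is what makes every operator
  below respect the identification of q-functions that agree on the domain.\<close>

lemma eventually_upd:
  assumes "p \<in> qdom X" shows "eventually (\<lambda>t. upd v t p \<in> qdom X) (nhds (coord v p))"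
  using open_upd[of v p] assms by (auto simp: eventually_nhds intro!: exI[of _ "{t. upd v t p \<in> qdom X}"])

lemma pd_cong:
  assumes "qeq X f g" shows "qeq X (pd v f) (pd v g)"
proof (rule qeqI)
  fix x q assume p: "(x, q) \<in> qdom X"
  show "pd v f x q = pd v g x q"
    unfolding pd_eq_deriv using assms
    by (intro deriv_cong_ev eventually_mono[OF eventually_upd[OF p]]) (auto simp: qeq_iff)
qed

lemma has_pd_cong:
  assumes "qeq X f g" "qeq X f' g'" "has_pd X v f f'"
  shows "has_pd X v g g'"
  unfolding has_pd_def
proof
  fix p assume p: "p \<in> qdom X"
  have "((\<lambda>t. case_prod g (upd v t p)) has_real_derivative case_prod g' p) (at (coord v p)) \<longleftrightarrow>
     ((\<lambda>t. case_prod f (upd v t p)) has_real_derivative case_prod f' p) (at (coord v p))"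
    using assms(1,2) p by (intro DERIV_cong_ev eventually_mono[OF eventually_upd[OF p]]) (auto simp: qeq_iff)
  then show "((\<lambda>t. case_prod g (upd v t p)) has_real_derivative case_prod g' p) (at (coord v p))"
    using assms(3) p by (auto simp: has_pd_def)
qed

lemma has_pd_unique: "has_pd X v f f' \<Longrightarrow> qeq X (pd v f) f'"
  by (auto simp: has_pd_def pd_eq_deriv qeq_def intro!: DERIV_imp_deriv)

lemma Ck_on_cong: "qeq X f g \<Longrightarrow> Ck_on X k f \<Longrightarrow> Ck_on X k g"
proof (induction k arbitrary: f g)
  case 0
  then show ?case by (auto simp: Ck_on_0 qeq_iff cong: continuous_on_cong)
next
  case (Suc k)
  then have "continuous_on (qdom X) (case_prod g)"
    by (auto simp: Ck_on_Suc qeq_iff cong: continuous_on_cong)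
  moreover have "has_pd X v g (pd v g)" for v
    using Suc.prems has_pd_cong[OF Suc.prems(1) pd_cong[OF Suc.prems(1)]] by (auto simp: Ck_on_Suc)
  moreover have "Ck_on X k (pd v g)" for v
    using Suc.prems Suc.IH[OF pd_cong[OF Suc.prems(1)]] by (auto simp: Ck_on_Suc)
  ultimately show ?case by (auto simp: Ck_on_Suc)
qed

text \<open>Allows smoothness to be proved from explicit formulas for the partial derivatives,
  so that the closure properties below become inductions on the order.\<close>

lemma Ck_on_SucI:
  assumes "continuous_on (qdom X) (case_prod f)"
    and "\<And>v. has_pd X v f (f' v)" "\<And>v. Ck_on X k (f' v)"
  shows "Ck_on X (Suc k) f"
  unfolding Ck_on_Suc using assms
  by (meson Ck_on_cong has_pd_cong has_pd_unique qeq_refl qeq_sym)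

lemma Ck_on_continuous: "Ck_on X k f \<Longrightarrow> continuous_on (qdom X) (case_prod f)"
  by (cases k) (auto simp: Ck_on_0 Ck_on_Suc)

lemma Ck_on_SucD: "Ck_on X (Suc k) f \<Longrightarrow> Ck_on X k f"
  by (induction k arbitrary: f) (auto simp: Ck_on_0 Ck_on_Suc)

lemma has_pd_add: "has_pd X v f f' \<Longrightarrow> has_pd X v g g' \<Longrightarrow>
    has_pd X v (\<lambda>x q. f x q + g x q) (\<lambda>x q. f' x q + g' x q)"
  unfolding has_pd_def by (auto simp: split_beta intro!: DERIV_add)

lemma has_pd_mult: "has_pd X v f f' \<Longrightarrow> has_pd X v g g' \<Longrightarrow>
    has_pd X v (\<lambda>x q. f x q * g x q) (\<lambda>x q. f x q * g' x q + f' x q * g x q)"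
  unfolding has_pd_def by (auto simp: split_beta intro!: derivative_eq_intros)

lemma has_pd_const: "has_pd X v (\<lambda>x q. c) (\<lambda>x q. 0)"
  unfolding has_pd_def by (auto simp: split_beta)

lemma has_pd_sum: "(\<And>i. i \<in> I \<Longrightarrow> has_pd X v (f i) (f' i)) \<Longrightarrow>
    has_pd X v (\<lambda>x q. \<Sum>i\<in>I. f i x q) (\<lambda>x q. \<Sum>i\<in>I. f' i x q)"
  by (induction I rule: infinite_finite_induct) (auto intro: has_pd_const has_pd_add)

lemma has_pd_q: "has_pd X v (\<lambda>x q. q j) (\<lambda>x q. if v = Some j then 1 else 0)"
  unfolding has_pd_def by (cases v) (auto simp: split_beta)

lemma Ck_on_add: "Ck_on X k f \<Longrightarrow> Ck_on X k g \<Longrightarrow> Ck_on X k (\<lambda>x q. f x q + g x q)"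
proof (induction k arbitrary: f g)
  case 0 then show ?case by (auto simp: Ck_on_0 split_beta intro!: continuous_intros)
next
  case (Suc k)
  then show ?case
    by (intro Ck_on_SucI[OF _ has_pd_add]) 
      (auto simp: split_beta Ck_on_Suc intro!: continuous_intros)
qed

lemma Ck_on_mult: "Ck_on X k f \<Longrightarrow> Ck_on X k g \<Longrightarrow> Ck_on X k (\<lambda>x q. f x q * g x q)"
proof (induction k arbitrary: f g)
  case 0 then show ?case by (auto simp: Ck_on_0 split_beta intro!: continuous_intros)
next
  case (Suc k)
  then have "Ck_on X k f" "Ck_on X k g" by (auto dest: Ck_on_SucD)
  with Suc show ?case
    by (intro Ck_on_SucI[OF _ has_pd_mult] Ck_on_add)
      (auto simp: split_beta Ck_on_Suc intro!: continuous_intros)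
qed

lemma Ck_on_const: "Ck_on X k (\<lambda>x q. c)"
  by (induction k arbitrary: c) (auto simp: Ck_on_0 split_beta intro!: Ck_on_SucI has_pd_const)

lemma Ck_on_q: "Ck_on X k (\<lambda>x q. q j)"
proof (cases k)
  case 0 then show ?thesis by (auto simp: Ck_on_0 split_beta intro!: continuous_intros)
next
  case (Suc k')
  then show ?thesis
    by (auto intro!: Ck_on_SucI[OF _ has_pd_q Ck_on_const] continuous_intros simp: split_beta)
qed

text \<open>Restricting to the two variables in question reduces the claim to a function of
  two real variables on an open subset of the plane.\<close>

lemma pd_commute:
  assumes "Ck_on X 2 f"
  shows "qeq X (pd v (pd w f)) (pd w (pd v f))"
proof (rule qeqI)
  fix x q assume p: "(x, q) \<in> qdom X"
  define p where "p = (x, q)"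
  have C: "has_pd X v f (pd v f)" "has_pd X v (pd w f) (pd v (pd w f))" 
      "continuous_on (qdom X) (case_prod (pd v (pd w f)))" for v w
    using assms by (auto simp: numeral_2_eq_2 Ck_on_Suc Ck_on_0)
  show "pd v (pd w f) x q = pd w (pd v f) x q"
  proof (cases "v = w")
    case ne: False
    define G where "G = (\<lambda>s t. upd v s (upd w t p))"
    define U where "U = {(s, t). G s t \<in> qdom X}"
    have Gc: "continuous_on S (\<lambda>(s, t). G s t)" for S
      by (auto simp: G_def split_beta intro!: continuous_intros)
    have oU: "open U"
      using open_vimage[OF open_qdom Gc] by (simp add: U_def vimage_def case_prod_unfold)
    have Gp: "G (coord v p) (coord w p) = p" by (simp add: G_def)
    have d1: "((\<lambda>s. case_prod h (G s t)) has_real_derivative case_prod h' (G s t)) (at s)"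
      if "(s, t) \<in> U" "has_pd X v h h'" for s t h h'
      using that unfolding has_pd_def U_def by (auto simp: G_def dest!: bspec)
    have d2: "((\<lambda>t. case_prod h (G s t)) has_real_derivative case_prod h' (G s t)) (at t)"
      if "(s, t) \<in> U" "has_pd X w h h'" for s t h h'
      using that unfolding has_pd_def U_def by (auto simp: G_def upd_commute[OF ne] dest!: bspec)
    have cc: "continuous_on U (\<lambda>(s, t). case_prod h (G s t))" if "continuous_on (qdom X) (case_prod h)" for h
      using continuous_on_compose2[OF that Gc, of U]
      by (force simp: U_def case_prod_unfold)
    have "case_prod (pd w (pd v f)) (G (coord v p) (coord w p)) = case_prod (pd v (pd w f)) (G (coord v p) (coord w p))"
      using p
      by (intro mixed_partials_commute[where F = "\<lambda>s t. case_prod f (G s t)" and U = U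
          and Fs = "\<lambda>s t. case_prod (pd v f) (G s t)" and Ft = "\<lambda>s t. case_prod (pd w f) (G s t)"]
          oU d1 d2 C cc) (auto simp: U_def Gp, simp add: p_def)
    then show ?thesis unfolding Gp by (simp add: p_def)
  qed auto
qed

section \<open>The algebra of q-functions\<close>

abbreviation dom where "dom \<equiv> qdom X"
abbreviation qequiv (infix "\<doteq>" 50) where "f \<doteq> g \<equiv> qeq X f g"
abbreviation qf where "qf \<equiv> q_function X"
abbreviation qorder where "qorder \<equiv> q_function_of_order X"

lemma qorderI:
  "(\<And>x q q'. (x, q) \<in> dom \<Longrightarrow> \<forall>j\<le>m. q' j = q j \<Longrightarrow> f x q' = f x q) \<Longrightarrow> (\<And>k. Ck_on X k f) \<Longrightarrow> qorder m f"
  unfolding q_function_of_order_def by blast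

lemma qorder_indep: "qorder m f \<Longrightarrow> (x, q) \<in> dom \<Longrightarrow> \<forall>j\<le>m. q' j = q j \<Longrightarrow> f x q' = f x q"
  and qorder_Ck: "qorder m f \<Longrightarrow> Ck_on X k f"
  unfolding q_function_of_order_def by blast+

lemma qorder_cong:
  assumes "f \<doteq> g" "qorder m f" shows "qorder m g"
proof (rule qorderI)
  fix x q q' assume q: "(x, q) \<in> dom" "\<forall>j\<le>m. q' j = q j"
  then have "(x, q') \<in> dom" by (simp add: qdom_def)
  then show "g x q' = g x q"
    using qorder_indep[OF assms(2) q] qeqD[OF assms(1)] q(1) by simp
qed (rule Ck_on_cong[OF assms(1) qorder_Ck[OF assms(2)]])

lemma qf_cong: "f \<doteq> g \<Longrightarrow> qf f \<Longrightarrow> qf g"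
  unfolding q_function_def by (blast intro: qorder_cong)

lemma qorder_mono:
  assumes f: "qorder m f" and "m \<le> n" shows "qorder n f"
proof (rule qorderI)
  fix x q q' assume "(x, q) \<in> dom" "\<forall>j\<le>n. q' j = q j"
  then show "f x q' = f x q"
    using \<open>m \<le> n\<close> by (intro qorder_indep[OF f]) auto
qed (rule qorder_Ck[OF f])

lemma qorder_has_pd: "qorder m f \<Longrightarrow> has_pd X v f (pd v f)"
  using qorder_Ck[of m f "Suc 0"] by (simp add: Ck_on_Suc)

lemma qorder_add:
  assumes f: "qorder m f" and g: "qorder m g"
  shows "qorder m (\<lambda>x q. f x q + g x q)"
proof (rule qorderI)
  fix x q q' assume "(x, q) \<in> dom" "\<forall>j\<le>m. q' j = q j"
  then show "f x q' + g x q' = f x q + g x q"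
    using qorder_indep[OF f, of x q q'] qorder_indep[OF g, of x q q'] by metis
qed (intro Ck_on_add qorder_Ck[OF f] qorder_Ck[OF g])

lemma qorder_mult:
  assumes f: "qorder m f" and g: "qorder m g"
  shows "qorder m (\<lambda>x q. f x q * g x q)"
proof (rule qorderI)
  fix x q q' assume "(x, q) \<in> dom" "\<forall>j\<le>m. q' j = q j"
  then show "f x q' * g x q' = f x q * g x q"
    using qorder_indep[OF f, of x q q'] qorder_indep[OF g, of x q q'] by metis
qed (intro Ck_on_mult qorder_Ck[OF f] qorder_Ck[OF g])

lemma qorder_const: "qorder m (\<lambda>x q. c)"
  by (intro qorderI Ck_on_const refl)

lemma qorder_coord: "j \<le> m \<Longrightarrow> qorder m (\<lambda>x q. q j)"
  by (intro qorderI Ck_on_q) simp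

lemma qorder_sum: "(\<And>i. i \<in> I \<Longrightarrow> qorder m (f i)) \<Longrightarrow> qorder m (\<lambda>x q. \<Sum>i\<in>I. f i x q)"
  by (induction I rule: infinite_finite_induct) (auto intro: qorder_const qorder_add)

text \<open>The sequence \<open>q'\<close> lets the derivative be evaluated at a point that differs from
  \<open>q\<close> in the irrelevant coordinates, as is needed in \<open>qorder_pd\<close>.\<close>

lemma dq_eq_0:
  assumes "qorder m f" "m < j" "(x, q) \<in> dom" "\<forall>i\<le>m. q' i = q i"
  shows "dq j f x q' = 0"
proof -
  have "f x (q'(j := t)) = f x q" for t
    using assms by (intro qorder_indep[OF assms(1)]) auto
  then show ?thesis by (simp add: dq_def)
qed

lemma dq_vanishes: "qorder m f \<Longrightarrow> m < j \<Longrightarrow> dq j f \<doteq> (\<lambda>x q. 0)"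
  by (rule qeqI) (auto intro: dq_eq_0)

lemma qorder_pd:
  assumes "qorder m f" shows "qorder m (pd v f)"
proof (rule qorderI)
  fix k show "Ck_on X k (pd v f)"
    using qorder_Ck[OF assms, of "Suc k"] by (simp add: Ck_on_Suc)
next
  fix x q q' assume q: "(x, q) \<in> dom" "\<forall>j\<le>m. q' j = q j"
  show "pd v f x q' = pd v f x q"
  proof (cases "\<exists>j. v = Some j \<and> m < j")
    case True
    then show ?thesis using dq_eq_0[OF assms _ q(1)] q(2) by auto
  next
    case False
    then have c: "coord v (x, q') = coord v (x, q)"
      using q(2) by (cases v) auto
    have "case_prod f (upd v t (x, q')) = case_prod f (upd v t (x, q))" if "upd v t (x, q) \<in> dom" for t
    proof (cases v)
      case None
      then show ?thesis using that q(2) qorder_indep[OF assms, of t q q'] by simp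
    next
      case (Some j)
      then show ?thesis using that q(2) qorder_indep[OF assms, of x "q(j := t)" "q'(j := t)"] by simp
    qed
    then show ?thesis
      unfolding pd_eq_deriv c
      by (intro deriv_cong_ev eventually_mono[OF eventually_upd[OF q(1)]]) auto
  qed
qed

lemmas qorder_dx = qorder_pd[of _ _ None, simplified]
  and qorder_dq = qorder_pd[of _ _ "Some j" for j, simplified]

lemma qfI: "qorder m f \<Longrightarrow> qf f"
  by (auto simp: q_function_def)

lemma qfE: assumes "qf f" obtains m where "qorder m f" "n \<le> m"
proof -
  obtain m where "qorder m f" using assms by (auto simp: q_function_def)
  then have "qorder (max m n) f" by (rule qorder_mono) simp
  then show ?thesis using that by simp
qed

lemma qf2E:
  assumes "qf f" "qf g" obtains m where "qorder m f" "qorder m g"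
proof -
  obtain m where m: "qorder m f" using assms(1) by (auto simp: q_function_def)
  obtain n where "qorder n g" "m \<le> n" using assms(2) by (rule qfE)
  with m show ?thesis using that qorder_mono by blast
qed

lemma qf_add: "qf f \<Longrightarrow> qf g \<Longrightarrow> qf (\<lambda>x q. f x q + g x q)"
  by (erule (1) qf2E) (blast intro: qfI qorder_add)

lemma qf_mult: "qf f \<Longrightarrow> qf g \<Longrightarrow> qf (\<lambda>x q. f x q * g x q)"
  by (erule (1) qf2E) (blast intro: qfI qorder_mult)

lemma qf_const: "qf (\<lambda>x q. c)" and qf_coord: "qf (\<lambda>x q. q j)"
  by (auto intro: qfI qorder_const qorder_coord)

lemma qf_sum: "(\<And>i. i \<in> I \<Longrightarrow> qf (f i)) \<Longrightarrow> qf (\<lambda>x q. \<Sum>i\<in>I. f i x q)"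
  by (induction I rule: infinite_finite_induct) (auto intro: qf_const qf_add)

lemma qf_pd: "qf f \<Longrightarrow> qf (pd v f)"
  unfolding q_function_def by (blast intro: qorder_pd)

lemmas qf_dx = qf_pd[of _ None, simplified] and qf_dq = qf_pd[of _ "Some j" for j, simplified]

lemma qf_has_pd: "qf f \<Longrightarrow> has_pd X v f (pd v f)"
  unfolding q_function_def by (blast intro: qorder_has_pd)

lemmas pd_add = has_pd_unique[OF has_pd_add[OF qf_has_pd qf_has_pd]]
  and pd_mult = has_pd_unique[OF has_pd_mult[OF qf_has_pd qf_has_pd]]
  and pd_coord = has_pd_unique[OF has_pd_q]

section \<open>The total derivative\<close>

lemma dq_commute: "qf f \<Longrightarrow> dq i (dq j f) \<doteq> dq j (dq i f)"
  and dq_dx_commute: "qf f \<Longrightarrow> dq i (dx f) \<doteq> dx (dq i f)"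
  using pd_commute[of f "Some i" "Some j"] pd_commute[of f "Some i" None]
  by (auto simp: q_function_def dest: qorder_Ck)

text \<open>The number of summands may be taken as any order of the function. Two
  q-functions always have an order in common, so identities between operators reduce
  to identities between sums over the same finite range.\<close>

lemma total_D_eq:
  assumes "qorder m f" "(x, q) \<in> dom"
  shows "total_D f x q = dx f x q + (\<Sum>j\<le>m. q (Suc j) * dq j f x q)"
  unfolding total_D_def using dq_eq_0[OF assms(1) _ assms(2)]
  by (subst suminf_finite[of "{..m}"]) auto

lemma total_D_cong: assumes "f \<doteq> g" shows "total_D f \<doteq> total_D g"
proof (rule qeqI)
  fix x q assume p: "(x, q) \<in> dom"
  have "dx f x q = dx g x q" "dq j f x q = dq j g x q" for j
    using qeqD[OF pd_cong[OF assms, of None] p] qeqD[OF pd_cong[OF assms, of "Some j"] p] by simp_all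
  then show "total_D f x q = total_D g x q" by (simp add: total_D_def)
qed

lemma qorder_total_D:
  assumes "qorder m f" shows "qorder (Suc m) (total_D f)"
proof (rule qorder_cong)
  have "qorder (Suc m) f" using assms by (rule qorder_mono) simp
  then show "qorder (Suc m) (\<lambda>x q. dx f x q + (\<Sum>j\<le>m. q (Suc j) * dq j f x q))"
    by (intro qorder_add qorder_sum qorder_mult qorder_coord qorder_dx qorder_dq) auto
  show "(\<lambda>x q. dx f x q + (\<Sum>j\<le>m. q (Suc j) * dq j f x q)) \<doteq> total_D f"
    using assms by (intro qeqI) (simp add: total_D_eq)
qed

lemma qf_total_D: "qf f \<Longrightarrow> qf (total_D f)"
  unfolding q_function_def by (blast intro: qorder_total_D)

lemma total_D_add:
  assumes "qf f" "qf g"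
  shows "total_D (\<lambda>x q. f x q + g x q) \<doteq> (\<lambda>x q. total_D f x q + total_D g x q)"
proof (rule qeqI)
  fix x q assume p: "(x, q) \<in> dom"
  obtain m where m: "qorder m f" "qorder m g" using assms qf2E by blast
  show "total_D (\<lambda>x q. f x q + g x q) x q = total_D f x q + total_D g x q"
    using qeqD[OF pd_add[OF assms, of None] p] qeqD[OF pd_add[OF assms, of "Some j" for j] p]
    by (simp add: total_D_eq[OF m(1) p] total_D_eq[OF m(2) p] total_D_eq[OF qorder_add[OF m] p] algebra_simps sum.distrib)
qed

text \<open>\<open>D\<close> is a derivation because it is a combination of partial derivatives.\<close>

lemma total_D_mult:
  assumes "qf f" "qf g"
  shows "total_D (\<lambda>x q. f x q * g x q) \<doteq> (\<lambda>x q. f x q * total_D g x q + total_D f x q * g x q)"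
proof (rule qeqI)
  fix x q assume p: "(x, q) \<in> dom"
  obtain m where m: "qorder m f" "qorder m g" using assms qf2E by blast
  show "total_D (\<lambda>x q. f x q * g x q) x q = f x q * total_D g x q + total_D f x q * g x q"
    using qeqD[OF pd_mult[OF assms, of None] p] qeqD[OF pd_mult[OF assms, of "Some j" for j] p]
    by (simp add: total_D_eq[OF m(1) p] total_D_eq[OF m(2) p] total_D_eq[OF qorder_mult[OF m] p]
        algebra_simps sum.distrib sum_distrib_left)
qed

lemma total_D_const: "total_D (\<lambda>x q. c) \<doteq> (\<lambda>x q. 0)"
  by (rule qeqI) (simp add: total_D_def dx_def dq_def)

lemma total_D_sum:
  "(\<And>i. i \<in> I \<Longrightarrow> qf (f i)) \<Longrightarrow> total_D (\<lambda>x q. \<Sum>i\<in>I. f i x q) \<doteq> (\<lambda>x q. \<Sum>i\<in>I. total_D (f i) x q)"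
proof (induction I rule: infinite_finite_induct)
  case (insert i I)
  have "total_D (\<lambda>x q. f i x q + (\<Sum>i\<in>I. f i x q)) \<doteq> (\<lambda>x q. total_D (f i) x q + total_D (\<lambda>x q. \<Sum>i\<in>I. f i x q) x q)"
    using insert.prems by (intro total_D_add qf_sum) auto
  with insert.IH insert.prems insert.hyps show ?case
    by (intro qeqI) (simp add: qeqD[of X])
qed (simp_all add: total_D_const)

lemma total_D_coord: "total_D (\<lambda>x q. q j) \<doteq> (\<lambda>x q. q (Suc j))"
proof (rule qeqI)
  fix x q assume p: "(x, q) \<in> dom"
  have "q (Suc i) * dq i (\<lambda>x q. q j) x q = (if i = j then q (Suc j) else 0)" for i
    using qeqD[OF pd_coord[of "Some i" j] p] by (auto split: if_splits)
  moreover have "dx (\<lambda>x q. q j) x q = 0"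
    using qeqD[OF pd_coord[of None j] p] by auto
  ultimately show "total_D (\<lambda>x q. q j) x q = q (Suc j)"
    unfolding total_D_eq[OF qorder_coord[OF order.refl] p] by simp
qed

lemma total_D_cmult: "qf f \<Longrightarrow> total_D (\<lambda>x q. c * f x q) \<doteq> (\<lambda>x q. c * total_D f x q)"
  using total_D_mult[OF qf_const[of c], of f] total_D_const[of c]
  by (intro qeqI) (simp add: qeqD[of X])

abbreviation Dk where "Dk k \<equiv> total_D ^^ k"

lemma Dk_cong: "f \<doteq> g \<Longrightarrow> Dk k f \<doteq> Dk k g"
  by (induction k) (auto intro: total_D_cong)

lemma qf_Dk: "qf f \<Longrightarrow> qf (Dk k f)"
  by (induction k) (auto intro: qf_total_D)

lemma Dk_add: "qf f \<Longrightarrow> qf g \<Longrightarrow> Dk k (\<lambda>x q. f x q + g x q) \<doteq> (\<lambda>x q. Dk k f x q + Dk k g x q)"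
proof (induction k)
  case (Suc k)
  then show ?case
    using qeq_trans[OF total_D_cong[OF Suc.IH] total_D_add] by (simp add: qf_Dk)
qed simp

lemma Dk_zero: "Dk k (\<lambda>x q. 0) \<doteq> (\<lambda>x q. 0)"
proof (induction k)
  case (Suc k)
  show ?case using qeq_trans[OF total_D_cong[OF Suc.IH] total_D_const] by simp
qed simp

lemma Dk_vanishes: "f \<doteq> (\<lambda>x q. 0) \<Longrightarrow> Dk k f \<doteq> (\<lambda>x q. 0)"
  using qeq_trans[OF Dk_cong Dk_zero] by blast

text \<open>The coefficient of \<open>\<partial>/\<partial>q\<^sub>j\<close> in \<open>D\<close> is \<open>q\<^bsub>j+1\<^esub>\<close>, so differentiating it in
  \<open>q\<^sub>k\<close> leaves exactly the summand with \<open>j + 1 = k\<close>; everything else commutes.\<close>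

lemma dq_total_D:
  assumes "qf f"
  shows "dq k (total_D f) \<doteq> (\<lambda>x q. total_D (dq k f) x q + (if k = 0 then 0 else dq (k - 1) f x q))"
proof (rule qeqI)
  fix x q assume p: "(x, q) \<in> dom"
  obtain m where m: "qorder m f" "k \<le> m" using assms by (rule qfE)
  have "has_pd X (Some k) (\<lambda>x q. dx f x q + (\<Sum>j\<le>m. q (Suc j) * dq j f x q))
     (\<lambda>x q. dq k (dx f) x q + (\<Sum>j\<le>m. q (Suc j) * dq k (dq j f) x q
         + (if Some k = Some (Suc j) then 1 else 0) * dq j f x q))"
    using assms
    by (intro has_pd_add has_pd_sum has_pd_mult has_pd_q)
      (use qf_has_pd[of _ "Some k"] in \<open>auto intro: qf_dx qf_dq\<close>)
  moreover have "(\<lambda>x q. dx f x q + (\<Sum>j\<le>m. q (Suc j) * dq j f x q)) \<doteq> total_D f"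
    using m by (intro qeqI) (simp add: total_D_eq)
  ultimately have "has_pd X (Some k) (total_D f)
     (\<lambda>x q. dq k (dx f) x q + (\<Sum>j\<le>m. q (Suc j) * dq k (dq j f) x q
         + (if Some k = Some (Suc j) then 1 else 0) * dq j f x q))"
    using has_pd_cong qeq_refl by blast
  from qeqD[OF has_pd_unique[OF this] p]
  have "dq k (total_D f) x q = dq k (dx f) x q + (\<Sum>j\<le>m. q (Suc j) * dq k (dq j f) x q)
      + (\<Sum>j\<le>m. if k = Suc j then dq j f x q else 0)"
    by (simp add: sum.distrib if_distrib[where f = "\<lambda>c. c * _"] cong: if_cong)
  also have "(\<Sum>j\<le>m. if k = Suc j then dq j f x q else 0) = (if k = 0 then 0 else dq (k - 1) f x q)"
    using m(2) by (cases k) auto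
  also have "dq k (dx f) x q + (\<Sum>j\<le>m. q (Suc j) * dq k (dq j f) x q) = total_D (dq k f) x q"
    using qeqD[OF dq_dx_commute[OF assms] p] qeqD[OF dq_commute[OF assms, of k] p]
    by (simp add: total_D_eq[OF qorder_dq[OF m(1)] p])
  finally show "dq k (total_D f) x q = total_D (dq k f) x q + (if k = 0 then 0 else dq (k - 1) f x q)" .
qed

section \<open>The operators \<open>L\<close> and \<open>\<Lambda>\<close>\<close>

lemma Lambda_eq:
  assumes "qorder m f" "(x, q) \<in> dom"
  shows "Lambda_op f x q = (\<Sum>k\<le>m. (-1) ^ k * Dk k (dq k f) x q)"
proof -
  have "Dk k (dq k f) x q = 0" if "m < k" for k
    using qeqD[OF Dk_vanishes[OF dq_vanishes[OF assms(1) that]] assms(2)] by simp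
  then show ?thesis
    unfolding Lambda_op_def by (subst suminf_finite[of "{..m}"]) auto
qed

lemma L_eq:
  assumes "qorder m f" "(x, q) \<in> dom"
  shows "L_op f x q = (\<Sum>k\<le>m. (-1) ^ (k + 1) * Dk k (\<lambda>x q. q 0 * dq k f x q) x q)"
proof -
  have "Dk k (\<lambda>x q. q 0 * dq k f x q) x q = 0" if "m < k" for k
  proof -
    have "(\<lambda>x q. q 0 * dq k f x q) \<doteq> (\<lambda>x q. 0)"
      using dq_vanishes[OF assms(1) that] by (intro qeqI) (simp add: qeqD)
    from qeqD[OF Dk_vanishes[OF this] assms(2)] show ?thesis .
  qed
  then show ?thesis
    unfolding L_op_def by (subst suminf_finite[of "{..m}"]) auto
qed

lemma Lambda_cong: assumes "f \<doteq> g" shows "Lambda_op f \<doteq> Lambda_op g"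
proof (rule qeqI)
  fix x q assume p: "(x, q) \<in> dom"
  have "Dk k (dq k f) x q = Dk k (dq k g) x q" for k
    using qeqD[OF Dk_cong[OF pd_cong[OF assms, of "Some k"]] p] by simp
  then show "Lambda_op f x q = Lambda_op g x q" by (simp add: Lambda_op_def)
qed

lemma L_cong: assumes "f \<doteq> g" shows "L_op f \<doteq> L_op g"
proof (rule qeqI)
  fix x q assume p: "(x, q) \<in> dom"
  have "(\<lambda>x q. q 0 * dq k f x q) \<doteq> (\<lambda>x q. q 0 * dq k g x q)" for k
    using pd_cong[OF assms, of "Some k"] by (intro qeqI) (simp add: qeqD[of X])
  from qeqD[OF Dk_cong[OF this] p]
  have "Dk k (\<lambda>x q. q 0 * dq k f x q) x q = Dk k (\<lambda>x q. q 0 * dq k g x q) x q" for k .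
  then show "L_op f x q = L_op g x q" by (simp add: L_op_def)
qed

lemma qf_Lambda: assumes "qf f" shows "qf (Lambda_op f)"
proof -
  obtain m where m: "qorder m f" using assms by (auto simp: q_function_def)
  have "qf (\<lambda>x q. \<Sum>k\<le>m. (-1) ^ k * Dk k (dq k f) x q)"
    using assms by (intro qf_sum qf_mult qf_const qf_Dk qf_dq)
  moreover have "(\<lambda>x q. \<Sum>k\<le>m. (-1) ^ k * Dk k (dq k f) x q) \<doteq> Lambda_op f"
    using m by (intro qeqI) (simp add: Lambda_eq)
  ultimately show ?thesis using qf_cong by blast
qed

lemma Lambda_add:
  assumes "qf f" "qf g"
  shows "Lambda_op (\<lambda>x q. f x q + g x q) \<doteq> (\<lambda>x q. Lambda_op f x q + Lambda_op g x q)"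
proof (rule qeqI)
  fix x q assume p: "(x, q) \<in> dom"
  obtain m where m: "qorder m f" "qorder m g" using assms by (rule qf2E)
  have "Dk k (dq k (\<lambda>x q. f x q + g x q)) x q = Dk k (dq k f) x q + Dk k (dq k g) x q" for k
    using qeqD[OF Dk_cong[OF pd_add[OF assms, of "Some k"]] p]
      qeqD[OF Dk_add[OF qf_dq[OF assms(1)] qf_dq[OF assms(2)]] p] by simp
  then show "Lambda_op (\<lambda>x q. f x q + g x q) x q = Lambda_op f x q + Lambda_op g x q"
    by (simp add: Lambda_eq[OF m(1) p] Lambda_eq[OF m(2) p] Lambda_eq[OF qorder_add[OF m] p]
        algebra_simps sum.distrib)
qed

text \<open>Only \<open>\<partial>/\<partial>q\<^sub>0\<close> acts on the factor \<open>q\<^sub>0\<close>, which contributes \<open>f\<close> itself; the remaining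
  terms are those of \<open>L\<close> with the opposite sign.\<close>

lemma Lambda_q0_mult:
  assumes "qf f"
  shows "Lambda_op (\<lambda>x q. q 0 * f x q) \<doteq> (\<lambda>x q. f x q - L_op f x q)"
proof (rule qeqI)
  fix x q assume p: "(x, q) \<in> dom"
  obtain m where m: "qorder m f" using assms by (auto simp: q_function_def)
  let ?h = "\<lambda>k x q. q 0 * dq k f x q"
  have h: "qf (?h k)" for k using assms by (intro qf_mult qf_coord qf_dq)
  have dq: "dq k (\<lambda>x q. q 0 * f x q) \<doteq> (\<lambda>x q. ?h k x q + (if k = 0 then 1 else 0) * f x q)" for k
    using has_pd_unique[OF has_pd_mult[OF has_pd_q[of "Some k" 0] qf_has_pd[OF assms]]] by auto
  have *: "Dk k (dq k (\<lambda>x q. q 0 * f x q)) x q = Dk k (?h k) x q + (if k = 0 then f x q else 0)" for k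
    using qeqD[OF Dk_cong[OF dq] p, of k k] by (cases k) auto
  have "Lambda_op (\<lambda>x q. q 0 * f x q) x q
      = (\<Sum>k\<le>m. (-1) ^ k * (Dk k (?h k) x q + (if k = 0 then f x q else 0)))"
    by (simp only: Lambda_eq[OF qorder_mult[OF qorder_coord[OF le0] m] p] *)
  also have "\<dots> = (\<Sum>k\<le>m. (-1) ^ k * Dk k (?h k) x q) + (\<Sum>k\<le>m. if k = 0 then f x q else 0)"
    unfolding sum.distrib[symmetric] by (rule sum.cong) (auto simp: distrib_left)
  also have "\<dots> = f x q - L_op f x q"
    by (simp add: L_eq[OF m p] sum_negf)
  finally show "Lambda_op (\<lambda>x q. q 0 * f x q) x q = f x q - L_op f x q" .
qed

text \<open>The Euler-Lagrange operator annihilates total derivatives: by the commutation rule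
  \<open>dq_total_D\<close>, with \<open>a\<^sub>k = D\<^bsup>k+1\<^esup> (\<partial>f/\<partial>q\<^sub>k)\<close> the alternating sum telescopes and leaves
  only \<open>a\<^bsub>m+1\<^esub>\<close>, which vanishes for \<open>f\<close> of order \<open>m\<close>.\<close>

lemma Lambda_total_D:
  assumes "qf f" shows "Lambda_op (total_D f) \<doteq> (\<lambda>x q. 0)"
proof (rule qeqI)
  fix x q assume p: "(x, q) \<in> dom"
  obtain m where m: "qorder m f" using assms by (auto simp: q_function_def)
  define a where "a k = Dk (Suc k) (dq k f) x q" for k
  have *: "Dk k (dq k (total_D f)) x q = a k + (if k = 0 then 0 else a (k - 1))" for k
  proof (cases k)
    case 0
    then show ?thesis using qeqD[OF dq_total_D[OF assms, of 0] p] by (simp add: a_def)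
  next
    case (Suc i)
    have "dq (Suc i) (total_D f) \<doteq> (\<lambda>x q. total_D (dq (Suc i) f) x q + dq i f x q)"
      using dq_total_D[OF assms, of "Suc i"] by simp
    from qeqD[OF Dk_cong[OF this, of "Suc i"] p]
      qeqD[OF Dk_add[OF qf_total_D[OF qf_dq[OF assms, of "Suc i"]] qf_dq[OF assms, of i], of "Suc i"] p]
    show ?thesis by (simp add: Suc a_def funpow_Suc_right del: funpow.simps(2))
  qed
  have "(\<Sum>k\<le>n. (-1) ^ k * (a k + (if k = 0 then 0 else a (k - 1)))) = (-1) ^ n * a n" for n
    by (induction n) (auto simp: algebra_simps)
  moreover have "a (Suc m) = 0"
    unfolding a_def by (rule qeqD[OF Dk_vanishes[OF dq_vanishes[OF m lessI]] p])
  ultimately show "Lambda_op (total_D f) x q = 0"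
    unfolding Lambda_eq[OF qorder_total_D[OF m] p] * by simp
qed

section \<open>The Euler operator\<close>

definition euler :: "qfun \<Rightarrow> qfun" where
  "euler f = (\<lambda>x q. \<Sum>j. q j * dq j f x q)"

lemma euler_eq:
  assumes "qorder m f" "(x, q) \<in> dom"
  shows "euler f x q = (\<Sum>j\<le>m. q j * dq j f x q)"
  unfolding euler_def using dq_eq_0[OF assms(1) _ assms(2)]
  by (subst suminf_finite[of "{..m}"]) auto

lemma euler_cong: assumes "f \<doteq> g" shows "euler f \<doteq> euler g"
proof (rule qeqI)
  fix x q assume p: "(x, q) \<in> dom"
  have "dq j f x q = dq j g x q" for j
    using qeqD[OF pd_cong[OF assms, of "Some j"] p] by simp
  then show "euler f x q = euler g x q" by (simp add: euler_def)
qed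

lemma qorder_euler: assumes "qorder m f" shows "qorder m (euler f)"
proof (rule qorder_cong)
  show "qorder m (\<lambda>x q. \<Sum>j\<le>m. q j * dq j f x q)"
    using assms by (intro qorder_sum qorder_mult qorder_coord qorder_dq) auto
  show "(\<lambda>x q. \<Sum>j\<le>m. q j * dq j f x q) \<doteq> euler f"
    using assms by (intro qeqI) (simp add: euler_eq)
qed

lemma qf_euler: "qf f \<Longrightarrow> qf (euler f)"
  unfolding q_function_def by (blast intro: qorder_euler)

lemma euler_add:
  assumes "qf f" "qf g"
  shows "euler (\<lambda>x q. f x q + g x q) \<doteq> (\<lambda>x q. euler f x q + euler g x q)"
proof (rule qeqI)
  fix x q assume p: "(x, q) \<in> dom"
  obtain m where m: "qorder m f" "qorder m g" using assms by (rule qf2E)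
  show "euler (\<lambda>x q. f x q + g x q) x q = euler f x q + euler g x q"
    using qeqD[OF pd_add[OF assms, of "Some j" for j] p]
    by (simp add: euler_eq[OF m(1) p] euler_eq[OF m(2) p] euler_eq[OF qorder_add[OF m] p]
        algebra_simps sum.distrib)
qed

lemma euler_mult:
  assumes "qf f" "qf g"
  shows "euler (\<lambda>x q. f x q * g x q) \<doteq> (\<lambda>x q. f x q * euler g x q + euler f x q * g x q)"
proof (rule qeqI)
  fix x q assume p: "(x, q) \<in> dom"
  obtain m where m: "qorder m f" "qorder m g" using assms by (rule qf2E)
  show "euler (\<lambda>x q. f x q * g x q) x q = f x q * euler g x q + euler f x q * g x q"
    using qeqD[OF pd_mult[OF assms, of "Some j" for j] p]
    by (simp add: euler_eq[OF m(1) p] euler_eq[OF m(2) p] euler_eq[OF qorder_mult[OF m] p]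
        algebra_simps sum.distrib sum_distrib_left)
qed

lemma euler_const: "euler (\<lambda>x q. c) \<doteq> (\<lambda>x q. 0)"
  by (rule qeqI) (simp add: euler_def dq_def)

lemma euler_lincomb:
  assumes "finite I" "\<And>i. i \<in> I \<Longrightarrow> qf (f i)"
  shows "euler (\<lambda>x q. \<Sum>i\<in>I. c i * f i x q) \<doteq> (\<lambda>x q. \<Sum>i\<in>I. c i * euler (f i) x q)"
  using assms
proof (induction I rule: finite_induct)
  case empty
  then show ?case using euler_const[of 0] by simp
next
  case (insert i I)
  have q: "qf (\<lambda>x q. c i * f i x q)" "qf (\<lambda>x q. \<Sum>i\<in>I. c i * f i x q)"
    using insert.prems by (auto intro!: qf_mult qf_const qf_sum)
  show ?case
  proof (rule qeqI)
    fix x q assume p: "(x, q) \<in> dom"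
    show "euler (\<lambda>x q. \<Sum>i\<in>insert i I. c i * f i x q) x q = (\<Sum>i\<in>insert i I. c i * euler (f i) x q)"
      using insert.hyps qeqD[OF euler_add[OF q] p] qeqD[OF insert.IH[OF insert.prems] p]
        qeqD[OF euler_mult[OF qf_const insert.prems] p, of i "c i"] qeqD[OF euler_const[of "c i"] p]
      by simp
  qed
qed

text \<open>\<open>D\<close> preserves the degree of homogeneity in \<open>q\<close>; infinitesimally, it commutes with
  the Euler operator. In coordinates both sides are the sum of
  \<open>q\<^sub>j D (\<partial>f/\<partial>q\<^sub>j)\<close> and \<open>q\<^bsub>j+1\<^esub> \<partial>f/\<partial>q\<^sub>j\<close>.\<close>

lemma euler_total_D:
  assumes "qf f" shows "euler (total_D f) \<doteq> total_D (euler f)"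
proof (rule qeqI)
  fix x q assume p: "(x, q) \<in> dom"
  obtain m where m: "qorder m f" using assms by (auto simp: q_function_def)
  have "total_D (euler f) x q = total_D (\<lambda>x q. \<Sum>j\<le>m. q j * dq j f x q) x q"
    using m by (intro qeqD[OF total_D_cong p] qeqI) (simp add: euler_eq)
  also have "\<dots> = (\<Sum>j\<le>m. q j * total_D (dq j f) x q + q (Suc j) * dq j f x q)"
  proof -
    have "qf (\<lambda>x q. q j * dq j f x q)" for j
      using assms by (intro qf_mult qf_coord qf_dq)
    from qeqD[OF total_D_sum[OF this] p] show ?thesis
      using qeqD[OF total_D_mult[OF qf_coord qf_dq[OF assms]] p] qeqD[OF total_D_coord p] by simp
  qed
  finally have D: "total_D (euler f) x q = (\<Sum>j\<le>m. q j * total_D (dq j f) x q) + (\<Sum>j\<le>m. q (Suc j) * dq j f x q)"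
    by (simp add: sum.distrib)
  have "euler (total_D f) x q =
     (\<Sum>j\<le>Suc m. q j * (total_D (dq j f) x q + (if j = 0 then 0 else dq (j - 1) f x q)))"
    using qeqD[OF dq_total_D[OF assms] p] by (simp add: euler_eq[OF qorder_total_D[OF m] p])
  also have "\<dots> = (\<Sum>j\<le>Suc m. q j * total_D (dq j f) x q) + (\<Sum>j\<le>Suc m. q j * (if j = 0 then 0 else dq (j - 1) f x q))"
    by (simp only: distrib_left sum.distrib)
  also have "(\<Sum>j\<le>Suc m. q j * (if j = 0 then 0 else dq (j - 1) f x q)) = (\<Sum>j\<le>m. q (Suc j) * dq j f x q)"
    by (subst sum.atMost_Suc_shift) simp
  also have "(\<Sum>j\<le>Suc m. q j * total_D (dq j f) x q) = (\<Sum>j\<le>m. q j * total_D (dq j f) x q)"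
    using qeqD[OF total_D_cong[OF dq_vanishes[OF m lessI]] p] qeqD[OF total_D_const[of 0] p] by simp
  finally show "euler (total_D f) x q = total_D (euler f) x q" using D by simp
qed

lemma euler_Dk: "qf f \<Longrightarrow> euler (Dk k f) \<doteq> Dk k (euler f)"
proof (induction k)
  case (Suc k)
  then show ?case
    using qeq_trans[OF euler_total_D[OF qf_Dk] total_D_cong] by simp
qed simp

lemma dq_euler:
  assumes "qf f" shows "dq k (euler f) \<doteq> (\<lambda>x q. euler (dq k f) x q + dq k f x q)"
proof (rule qeqI)
  fix x q assume p: "(x, q) \<in> dom"
  obtain m where m: "qorder m f" "k \<le> m" using assms by (rule qfE)
  have "has_pd X (Some k) (\<lambda>x q. \<Sum>j\<le>m. q j * dq j f x q)
     (\<lambda>x q. \<Sum>j\<le>m. q j * dq k (dq j f) x q + (if Some k = Some j then 1 else 0) * dq j f x q)"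
    using assms
    by (intro has_pd_add has_pd_sum has_pd_mult has_pd_q)
      (use qf_has_pd[of _ "Some k"] in \<open>auto intro: qf_dq\<close>)
  moreover have "(\<lambda>x q. \<Sum>j\<le>m. q j * dq j f x q) \<doteq> euler f"
    using m by (intro qeqI) (simp add: euler_eq)
  ultimately have "has_pd X (Some k) (euler f)
     (\<lambda>x q. \<Sum>j\<le>m. q j * dq k (dq j f) x q + (if Some k = Some j then 1 else 0) * dq j f x q)"
    using has_pd_cong qeq_refl by blast
  from qeqD[OF has_pd_unique[OF this] p]
  have "dq k (euler f) x q = (\<Sum>j\<le>m. q j * dq k (dq j f) x q) + (\<Sum>j\<le>m. if k = j then dq j f x q else 0)"
    by (simp add: sum.distrib if_distrib[where f = "\<lambda>c. c * _"] cong: if_cong)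
  then show "dq k (euler f) x q = euler (dq k f) x q + dq k f x q"
    using m(2) qeqD[OF dq_commute[OF assms, of k] p] by (simp add: euler_eq[OF qorder_dq[OF m(1)] p])
qed

text \<open>Each \<open>\<partial>/\<partial>q\<^sub>k\<close> lowers the degree of homogeneity by one and \<open>D\<close> keeps it, so \<open>\<Lambda>\<close>
  lowers it by one.\<close>

lemma Lambda_euler:
  assumes "qf f" shows "Lambda_op (euler f) \<doteq> (\<lambda>x q. euler (Lambda_op f) x q + Lambda_op f x q)"
proof (rule qeqI)
  fix x q assume p: "(x, q) \<in> dom"
  obtain m where m: "qorder m f" using assms by (auto simp: q_function_def)
  have q: "qf (dq k f)" for k using assms by (rule qf_dq)
  have "Dk k (dq k (euler f)) x q = euler (Dk k (dq k f)) x q + Dk k (dq k f) x q" for k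
    using qeqD[OF Dk_cong[OF dq_euler[OF assms]] p, of k k] qeqD[OF Dk_add[OF qf_euler[OF q] q] p, of k]
      qeqD[OF euler_Dk[OF q] p, of k k] by simp
  then have "Lambda_op (euler f) x q = (\<Sum>k\<le>m. (-1) ^ k * euler (Dk k (dq k f)) x q) + Lambda_op f x q"
    by (simp add: Lambda_eq[OF qorder_euler[OF m] p] Lambda_eq[OF m p] distrib_left sum.distrib)
  also have "(\<Sum>k\<le>m. (-1) ^ k * euler (Dk k (dq k f)) x q) = euler (\<lambda>x q. \<Sum>k\<le>m. (-1) ^ k * Dk k (dq k f) x q) x q"
    using qeqD[OF euler_lincomb[OF _ qf_Dk[OF q]] p, of "{..m}" "\<lambda>k. (-1) ^ k" "\<lambda>k. k" "\<lambda>k. k"] by simp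
  also have "\<dots> = euler (Lambda_op f) x q"
    using m by (intro qeqD[OF euler_cong p] qeqI) (simp add: Lambda_eq)
  finally show "Lambda_op (euler f) x q = euler (Lambda_op f) x q + Lambda_op f x q" .
qed

section \<open>Integration by parts\<close>

text \<open>Moving one \<open>D\<close> at a time from \<open>h\<close> onto the coordinate \<open>q\<^sub>j\<close> changes the sign and
  raises the index of the coordinate. The claim is proved for all \<open>j\<close> because the
  induction step from \<open>k\<close> uses it at \<open>j + 1\<close>.\<close>

lemma integrate_by_parts:
  "qf h \<Longrightarrow> \<exists>\<psi>. qf \<psi> \<and> (\<lambda>x q. q j * Dk k h x q) \<doteq> (\<lambda>x q. (-1) ^ k * (q (j + k) * h x q) + total_D \<psi> x q)"
proof (induction k arbitrary: j)
  case 0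
  show ?case
    by (rule exI[of _ "\<lambda>x q. 0"]) (auto intro!: qf_const qeqI simp: qeqD[OF total_D_const])
next
  case (Suc k)
  then obtain \<psi> where \<psi>: "qf \<psi>"
    "(\<lambda>x q. q (Suc j) * Dk k h x q) \<doteq> (\<lambda>x q. (-1) ^ k * (q (Suc j + k) * h x q) + total_D \<psi> x q)"
    by blast
  have q: "qf (\<lambda>x q. q j * Dk k h x q)" "qf (\<lambda>x q. - 1 * \<psi> x q)"
    by (intro qf_mult qf_coord qf_Dk Suc.prems) (rule qf_mult[OF qf_const \<psi>(1)])
  show ?case
  proof (intro exI conjI)
    show "qf (\<lambda>x q. q j * Dk k h x q + - 1 * \<psi> x q)" using q by (rule qf_add)
    show "(\<lambda>x q. q j * Dk (Suc k) h x q) \<doteq> (\<lambda>x q. (-1) ^ Suc k * (q (j + Suc k) * h x q) +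
        total_D (\<lambda>x q. q j * Dk k h x q + - 1 * \<psi> x q) x q)"
    proof (rule qeqI)
      fix x q assume p: "(x, q) \<in> dom"
      show "q j * Dk (Suc k) h x q = (-1) ^ Suc k * (q (j + Suc k) * h x q) +
        total_D (\<lambda>x q. q j * Dk k h x q + - 1 * \<psi> x q) x q"
        using qeqD[OF total_D_add[OF q] p] qeqD[OF total_D_mult[OF qf_coord qf_Dk[OF Suc.prems]] p, of j k]
          qeqD[OF total_D_coord p, of j] qeqD[OF total_D_cmult[OF \<psi>(1), of "-1"] p] qeqD[OF \<psi>(2) p]
        by simp
    qed
  qed
qed

text \<open>Modulo total derivatives, multiplication by \<open>q\<^sub>0\<close> turns \<open>\<Lambda>\<close> into the Euler operator:
  all derivatives \<open>D\<^sup>k\<close> in \<open>\<Lambda>\<close> are moved onto \<open>q\<^sub>0\<close>, where they produce \<open>q\<^sub>k\<close>.\<close>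

lemma q0_Lambda:
  assumes "qf f"
  shows "\<exists>\<psi>. qf \<psi> \<and> (\<lambda>x q. q 0 * Lambda_op f x q) \<doteq> (\<lambda>x q. euler f x q + total_D \<psi> x q)"
proof -
  obtain m where m: "qorder m f" using assms by (auto simp: q_function_def)
  have "\<forall>k. \<exists>\<psi>. qf \<psi> \<and> (\<lambda>x q. q 0 * Dk k (dq k f) x q) \<doteq> (\<lambda>x q. (-1) ^ k * (q (0 + k) * dq k f x q) + total_D \<psi> x q)"
    using integrate_by_parts[OF qf_dq[OF assms]] by blast
  from choice[OF this] obtain \<psi> where \<psi>: "\<And>k. qf (\<psi> k)"
    "\<And>k. (\<lambda>x q. q 0 * Dk k (dq k f) x q) \<doteq> (\<lambda>x q. (-1) ^ k * (q (0 + k) * dq k f x q) + total_D (\<psi> k) x q)"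
    by blast
  let ?\<Psi> = "\<lambda>x q. \<Sum>k\<le>m. (-1) ^ k * \<psi> k x q"
  have c: "qf (\<lambda>x q. (-1) ^ k * \<psi> k x q)" for k by (intro qf_mult qf_const \<psi>)
  then have q: "qf ?\<Psi>" by (intro qf_sum)
  have "(\<lambda>x q. q 0 * Lambda_op f x q) \<doteq> (\<lambda>x q. euler f x q + total_D ?\<Psi> x q)"
  proof (rule qeqI)
    fix x q assume p: "(x, q) \<in> dom"
    have "q 0 * Lambda_op f x q = (\<Sum>k\<le>m. (-1) ^ k * (q 0 * Dk k (dq k f) x q))"
      by (simp add: Lambda_eq[OF m p] sum_distrib_left mult.left_commute)
    also have "\<dots> = (\<Sum>k\<le>m. q k * dq k f x q + (-1) ^ k * total_D (\<psi> k) x q)"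
      using qeqD[OF \<psi>(2) p] by (simp add: distrib_left)
    also have "\<dots> = euler f x q + total_D ?\<Psi> x q"
      using qeqD[OF total_D_sum[OF c] p, of "\<lambda>k. k" "{..m}"] qeqD[OF total_D_cmult[OF \<psi>(1)] p]
      by (simp add: euler_eq[OF m p] sum.distrib)
    finally show "q 0 * Lambda_op f x q = euler f x q + total_D ?\<Psi> x q" .
  qed
  with q show ?thesis by blast
qed

section \<open>Derivatives along rays and homogeneity\<close>

text \<open>The ray through \<open>q\<close> in the first \<open>n\<close> coordinates only, with the others fixed at \<open>b\<close>;
  the chain rule along it is proved by induction on \<open>n\<close>.\<close>

definition ray :: "nat \<Rightarrow> (nat \<Rightarrow> real) \<Rightarrow> (nat \<Rightarrow> real) \<Rightarrow> real \<Rightarrow> nat \<Rightarrow> real" where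
  "ray n q b t = (\<lambda>j. if j < n then t * q j else b j)"

text \<open>In the variable \<open>u\<close> a continuous partial derivative is required, in the variable
  \<open>t\<close> mere differentiability at \<open>c\<close>. The asymmetry suits an induction in which the
  coordinates are set in motion one after the other.\<close>

lemma has_derivative_diagonal:
  fixes F :: "real \<Rightarrow> real \<Rightarrow> real"
  assumes c: "c \<in> T" "open T" "convex T"
    and x: "((\<lambda>t. F t c) has_real_derivative A) (at c)"
    and y: "\<And>t u. t \<in> T \<Longrightarrow> u \<in> T \<Longrightarrow> (F t has_real_derivative B t u) (at u)"
    and cont: "continuous_on (T \<times> T) (\<lambda>(t, u). B t u)"
  shows "((\<lambda>t. F t t) has_real_derivative A + B c c) (at c)"
proof -
  have "((\<lambda>(t, u). F t u) has_derivative (\<lambda>(t, u). A * t + blinfun_mult_right (B c c) u)) (at (c, c) within T \<times> T)"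
  proof (rule has_derivative_partialsI[where fx = "(*) A" and fy = "\<lambda>t u. blinfun_mult_right (B t u)"])
    show "((\<lambda>t. F t c) has_derivative (*) A) (at c within T)"
      using x by (simp add: has_field_derivative_def has_derivative_at_withinI)
    show "(F t has_derivative blinfun_apply (blinfun_mult_right (B t u))) (at u within T)" if "t \<in> T" "u \<in> T" for t u
      using y[OF that] by (simp add: has_field_derivative_def has_derivative_at_withinI blinfun_mult_right.rep_eq)
    have "continuous_on (T \<times> T) (\<lambda>(t, u). blinfun_mult_right (B t u))"
      using bounded_linear.continuous_on[OF bounded_linear_blinfun_mult_right cont]
      by (simp add: case_prod_unfold)
    then show "continuous (at (c, c) within T \<times> T) (\<lambda>(t, u). blinfun_mult_right (B t u))"
      using c by (simp add: continuous_on_eq_continuous_within)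
  qed (use c in auto)
  then have "((\<lambda>(t, u). F t u) has_derivative (\<lambda>(t, u). A * t + blinfun_mult_right (B c c) u)) (at (c, c))"
    using c by (simp add: at_within_open[OF _ open_Times])
  moreover have "((\<lambda>t. (t, t)) has_derivative (\<lambda>h. (h, h))) (at c)"
    by (auto intro!: derivative_eq_intros)
  ultimately have "((\<lambda>t. (\<lambda>(t, u). F t u) (t, t)) has_derivative (\<lambda>h. (\<lambda>(t, u). A * t + blinfun_mult_right (B c c) u) (h, h))) (at c)"
    by (rule has_derivative_compose[rotated])
  moreover have "(*) (A + B c c) = (\<lambda>h. A * h + B c c * h)"
    by (simp add: fun_eq_iff distrib_right)
  ultimately show ?thesis
    by (simp add: has_field_derivative_def blinfun_mult_right.rep_eq)
qed

text \<open>One more coordinate moves at each step of the induction: \<open>t\<close> drives the first \<open>n\<close>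
  coordinates and \<open>u\<close> the next one, and the diagonal \<open>t = u\<close> is the longer ray.\<close>

lemma deriv_ray:
  assumes f: "qf f" and x: "x \<in> X" and q: "q 0 > 0" and "b 0 > 0" "c > 0"
  shows "((\<lambda>t. f x (ray n q b t)) has_real_derivative (\<Sum>j<n. q j * dq j f x (ray n q b c))) (at c)"
  using assms(4)
proof (induction n arbitrary: b)
  case 0
  then show ?case by (simp add: ray_def)
next
  case (Suc n)
  define F where "F t u = f x ((ray n q b t)(n := u * q n))" for t u
  define B where "B t u = q n * dq n f x ((ray n q b t)(n := u * q n))" for t u
  have ray: "ray (Suc n) q b t = (ray n q b t)(n := t * q n)" for t
    by (auto simp: ray_def fun_eq_iff less_Suc_eq)
  have ray': "(ray n q b t)(n := u * q n) = ray n q (b(n := u * q n)) t" for t u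
    by (auto simp: ray_def fun_eq_iff)
  have dom: "(x, (ray n q b t)(n := u * q n)) \<in> dom" if "t > 0" "u > 0" for t u
    using x q Suc.prems that by (auto simp: qdom_def ray_def)
  have "((\<lambda>t. F t c) has_real_derivative (\<Sum>j<n. q j * dq j f x ((ray n q b c)(n := c * q n)))) (at c)"
    unfolding F_def ray' using Suc.prems q \<open>c > 0\<close> by (intro Suc.IH) simp
  moreover have "(F t has_real_derivative B t u) (at u)" if "t \<in> {0<..}" "u \<in> {0<..}" for t u
  proof -
    have "((\<lambda>s. f x ((ray n q b t)(n := s))) has_real_derivative dq n f x ((ray n q b t)(n := u * q n))) (at (u * q n))"
      using qf_has_pd[OF f, of "Some n"] dom[of t u] that
      by (auto simp: has_pd_def dest!: bspec)
    moreover have "((\<lambda>s. s * q n) has_real_derivative q n) (at u)"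
      by (auto intro!: derivative_eq_intros)
    ultimately show ?thesis
      unfolding F_def[abs_def] B_def using DERIV_chain2 by (fastforce simp: mult.commute)
  qed
  moreover have "continuous_on ({0<..} \<times> {0<..}) (\<lambda>(t, u). B t u)"
  proof -
    have "continuous_on dom (case_prod (dq n f))"
      using qf_dq[OF f] by (auto simp: q_function_def dest!: qorder_Ck intro: Ck_on_continuous)
    moreover have "continuous_on ({0<..} \<times> {0<..}) (\<lambda>p. (x, (ray n q b (fst p))(n := snd p * q n)))"
    proof (intro continuous_on_Pair continuous_on_const continuous_on_coordinatewise_then_product)
      fix i show "continuous_on ({0<..} \<times> {0<..}) (\<lambda>p. ((ray n q b (fst p))(n := snd p * q n)) i)"
        by (cases "i = n"; cases "i < n") (auto simp: ray_def intro!: continuous_intros)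
    qed
    ultimately have "continuous_on ({0<..} \<times> {0<..}) (\<lambda>p. case_prod (dq n f) (x, (ray n q b (fst p))(n := snd p * q n)))"
      by (rule continuous_on_compose2) (auto intro: dom)
    then show ?thesis unfolding B_def by (auto simp: case_prod_unfold intro!: continuous_intros)
  qed
  ultimately have "((\<lambda>t. F t t) has_real_derivative
      (\<Sum>j<n. q j * dq j f x ((ray n q b c)(n := c * q n))) + B c c) (at c)"
    using \<open>c > 0\<close> by (intro has_derivative_diagonal[where T = "{0<..}" and F = F and B = B]) auto
  then show ?case by (simp only: ray F_def B_def sum.lessThan_Suc)
qed

lemma deriv_scale:
  assumes f: "qf f" and p: "(x, q) \<in> dom" and c: "c > 0"
  shows "((\<lambda>t. f x (\<lambda>j. t * q j)) has_real_derivative euler f x (\<lambda>j. c * q j) / c) (at c)"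
proof -
  obtain m where m: "qorder m f" using f by (auto simp: q_function_def)
  have dom: "(x, \<lambda>j. t * q j) \<in> dom" if "t > 0" for t
    using p that by (simp add: qdom_def)
  have eq: "g x (ray (Suc m) q q t) = g x (\<lambda>j. t * q j)" if "t > 0" "qorder m g" for t g
    using that by (intro qorder_indep[OF _ dom]) (auto simp: ray_def)
  have "((\<lambda>t. f x (ray (Suc m) q q t)) has_real_derivative (\<Sum>j<Suc m. q j * dq j f x (ray (Suc m) q q c))) (at c)"
    using p c by (intro deriv_ray[OF f]) (auto simp: qdom_def)
  also have "(\<Sum>j<Suc m. q j * dq j f x (ray (Suc m) q q c)) = (\<Sum>j\<le>m. q j * dq j f x (\<lambda>j. c * q j))"
    using eq[OF c qorder_dq[OF m]] by (simp add: lessThan_Suc_atMost)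
  also have "\<dots> = euler f x (\<lambda>j. c * q j) / c"
    using c by (simp add: euler_eq[OF m dom[OF c]] sum_divide_distrib)
  finally show ?thesis
    by (rule has_field_derivative_transform_within_open[of _ _ _ "{0<..}"]) (use c eq m in auto)
qed

lemma euler_homogeneous_1:
  assumes "qf f" "q_homogeneous X 1 f" shows "euler f \<doteq> f"
proof (rule qeqI)
  fix x q assume p: "(x, q) \<in> dom"
  have "((\<lambda>t. t * f x q) has_real_derivative euler f x q) (at 1)"
    by (rule has_field_derivative_transform_within_open[OF deriv_scale[OF assms(1) p zero_less_one, simplified], of "{0<..}"])
      (use assms(2) p in \<open>auto simp: q_homogeneous_def\<close>)
  moreover have "((\<lambda>t. t * f x q) has_real_derivative f x q) (at 1)"
    by (auto intro!: derivative_eq_intros)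
  ultimately show "euler f x q = f x q" by (rule DERIV_unique)
qed

text \<open>The derivative of \<open>f\<close> along each ray vanishes, and the ray \<open>{0<..}\<close> of scaling
  factors stays in the domain and is connected.\<close>

lemma homogeneous_0_if_euler:
  assumes "qf f" "euler f \<doteq> (\<lambda>x q. 0)" shows "q_homogeneous X 0 f"
  unfolding q_homogeneous_def
proof safe
  fix c :: real and x q assume c: "c > 0" and p: "(x, q) \<in> dom"
  have "(x, \<lambda>j. t * q j) \<in> dom" if "t > 0" for t
    using p that by (simp add: qdom_def)
  then have "((\<lambda>t. f x (\<lambda>j. t * q j)) has_real_derivative 0) (at t within {0<..})" if "t \<in> {0<..}" for t
    using deriv_scale[OF assms(1) p, of t] qeqD[OF assms(2)] that by (simp add: has_field_derivative_at_within)
  then obtain k where "\<And>t. t > 0 \<Longrightarrow> f x (\<lambda>j. t * q j) = k"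
    using has_field_derivative_zero_constant[of "{0<..}" "\<lambda>t. f x (\<lambda>j. t * q j)"] by auto
  from this[OF c] this[of 1] show "f x (\<lambda>j. c * q j) = c powr 0 * f x q" using c by simp
qed

section \<open>Solutions of the key equation\<close>

text \<open>For \<open>\<phi>\<close> of degree one, \<open>E \<phi> = \<phi>\<close>, so \<open>q\<^sub>0 \<Lambda> \<phi>\<close> differs from \<open>\<phi>\<close> by a total derivative
  and \<open>(I - L) (\<Lambda> \<phi>) = \<Lambda> (q\<^sub>0 \<Lambda> \<phi>) = \<Lambda> \<phi>\<close>.\<close>

lemma L_Lambda:
  assumes \<phi>: "qf \<phi>" "q_homogeneous X 1 \<phi>"
  shows "L_op (Lambda_op \<phi>) \<doteq> (\<lambda>x q. 0)"
proof -
  obtain \<psi> where \<psi>: "qf \<psi>" "(\<lambda>x q. q 0 * Lambda_op \<phi> x q) \<doteq> (\<lambda>x q. euler \<phi> x q + total_D \<psi> x q)"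
    using q0_Lambda[OF \<phi>(1)] by blast
  have "(\<lambda>x q. q 0 * Lambda_op \<phi> x q) \<doteq> (\<lambda>x q. \<phi> x q + total_D \<psi> x q)"
    using euler_homogeneous_1[OF \<phi>] by (intro qeqI) (simp add: qeqD[OF \<psi>(2)] qeqD[of X])
  note \<Lambda> = Lambda_cong[OF this]
  show ?thesis
  proof (rule qeqI)
    fix x q assume p: "(x, q) \<in> dom"
    show "L_op (Lambda_op \<phi>) x q = 0"
      using qeqD[OF \<Lambda> p] qeqD[OF Lambda_add[OF \<phi>(1) qf_total_D[OF \<psi>(1)]] p]
        qeqD[OF Lambda_total_D[OF \<psi>(1)] p] qeqD[OF Lambda_q0_mult[OF qf_Lambda[OF \<phi>(1)]] p]
      by simp
  qed
qed

text \<open>With \<open>\<phi> = q\<^sub>0 s\<close> the equation \<open>L s = 0\<close> says \<open>\<Lambda> \<phi> = s\<close>. Then \<open>\<phi> = q\<^sub>0 \<Lambda> \<phi>\<close> equals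
  \<open>E \<phi>\<close> up to a total derivative, and applying \<open>\<Lambda>\<close> gives \<open>s = \<Lambda> (E \<phi>) = E s + s\<close>.\<close>

lemma homogeneous_0_if_L_zero:
  assumes s: "qf s" and L: "L_op s \<doteq> (\<lambda>x q. 0)"
  shows "q_homogeneous X 0 s"
proof (rule homogeneous_0_if_euler[OF s])
  define \<phi> where "\<phi> = (\<lambda>x q. q 0 * s x q)"
  have \<phi>: "qf \<phi>" unfolding \<phi>_def by (intro qf_mult qf_coord s)
  have \<Lambda>: "Lambda_op \<phi> \<doteq> s"
    using Lambda_q0_mult[OF s] L unfolding \<phi>_def by (intro qeqI) (simp add: qeqD[of X])
  obtain \<psi> where \<psi>: "qf \<psi>" "(\<lambda>x q. q 0 * Lambda_op \<phi> x q) \<doteq> (\<lambda>x q. euler \<phi> x q + total_D \<psi> x q)"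
    using q0_Lambda[OF \<phi>] by blast
  have "\<phi> \<doteq> (\<lambda>x q. euler \<phi> x q + total_D \<psi> x q)"
    by (intro qeqI) (simp add: qeqD[OF \<psi>(2), symmetric] qeqD[OF \<Lambda>], simp add: \<phi>_def)
  note \<Lambda>\<phi> = Lambda_cong[OF this]
  have "euler (Lambda_op \<phi>) \<doteq> (\<lambda>x q. 0)"
  proof (rule qeqI)
    fix x q assume p: "(x, q) \<in> dom"
    show "euler (Lambda_op \<phi>) x q = 0"
      using qeqD[OF \<Lambda>\<phi> p] qeqD[OF Lambda_add[OF qf_euler[OF \<phi>] qf_total_D[OF \<psi>(1)]] p]
        qeqD[OF Lambda_total_D[OF \<psi>(1)] p] qeqD[OF Lambda_euler[OF \<phi>] p]
      by simp
  qed
  with euler_cong[OF \<Lambda>] show "euler s \<doteq> (\<lambda>x q. 0)" by (meson qeq_sym qeq_trans)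
qed

lemma key_equation_iff: "key_equation X s \<longleftrightarrow> L_op s \<doteq> (\<lambda>x q. 0)"
  by (simp add: key_equation_def)

lemma homogeneous_q0_mult: "q_homogeneous X 0 g \<Longrightarrow> q_homogeneous X 1 (\<lambda>x q. q 0 * g x q)"
  by (auto simp: q_homogeneous_def)

end

theorem theorem6p4:
  fixes X :: "real set" and s :: qfun
  assumes "open X" and "is_interval X" and "q_function X s"
  shows "(key_local_score X s \<longleftrightarrow> key_equation X s) \<and>
    (key_equation X s \<longleftrightarrow>
      (\<exists>g. q_function X g \<and> q_homogeneous X 0 g \<and> qeq X s (\<lambda>x q. g x q - L_op g x q))) \<and>
    (key_equation X s \<longleftrightarrow>
      (\<exists>\<phi>. q_function X \<phi> \<and> q_homogeneous X 1 \<phi> \<and> qeq X s (Lambda_op \<phi>))) \<and>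
    (key_equation X s \<longrightarrow> q_homogeneous X 0 s)"
proof -
  interpret open_domain X using assms(1) by unfold_locales
  let ?ii = "\<exists>g. qf g \<and> q_homogeneous X 0 g \<and> s \<doteq> (\<lambda>x q. g x q - L_op g x q)"
  let ?iii = "\<exists>\<phi>. qf \<phi> \<and> q_homogeneous X 1 \<phi> \<and> s \<doteq> Lambda_op \<phi>"
  have hom: "q_homogeneous X 0 s" if "key_equation X s"
    using homogeneous_0_if_L_zero[OF assms(3)] that by (simp add: key_equation_iff)
  have "?ii" if "key_equation X s"
  proof (intro exI conjI)
    show "s \<doteq> (\<lambda>x q. s x q - L_op s x q)"
      using that by (intro qeqI) (simp add: key_equation_iff qeqD[of X])
  qed (use assms(3) hom[OF that] in auto)
  moreover have "?iii" if ?ii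
  proof -
    from that obtain g where g: "qf g" "q_homogeneous X 0 g" "s \<doteq> (\<lambda>x q. g x q - L_op g x q)"
      by blast
    have "qf (\<lambda>x q. q 0 * g x q)" by (intro qf_mult qf_coord g)
    moreover have "s \<doteq> Lambda_op (\<lambda>x q. q 0 * g x q)"
      using g(3) Lambda_q0_mult[OF g(1)] by (blast intro: qeq_sym qeq_trans)
    ultimately show ?thesis using homogeneous_q0_mult[OF g(2)] by blast
  qed
  moreover have "key_equation X s" if ?iii
  proof -
    from that obtain \<phi> where \<phi>: "qf \<phi>" "q_homogeneous X 1 \<phi>" "s \<doteq> Lambda_op \<phi>"
      by blast
    show ?thesis
      unfolding key_equation_iff using L_cong[OF \<phi>(3)] L_Lambda[OF \<phi>(1,2)] by (rule qeq_trans)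
  qed
  ultimately show ?thesis
    using hom assms(3) unfolding key_local_score_def by blast
qed

end
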